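(* Let $f \geq \max_{e \in E} |\mathcal{V}_e|$ be an upper bound on the maximum possible frequency of an edge, and let OPT be the optimal objective value of the primal LP (maximize $\sum_{e \in E} x(e)$ subject to $\sum_{e \in \mathcal{E}_v} x(e) \leq c_v$ for all $v \in V$ and $0 \leq x(e) \leq \mu$ for all $e \in E$). Then any $\lambda$-maximal feasible solution to this LP has objective value at least $\text{OPT}/(\lambda f + 1)$.
   Context: We are given a hypergraph $G=(V,E)$ with $|V|=n$ nodes and at most $m \geq |E|$ edges. For a node $v \in V$, $\mathcal{E}_v \subseteq E$ denotes the set of edges incident upon $v$, and for an edge $e \in E$, $\mathcal{V}_e = \{v \in V : e \in \mathcal{E}_v\}$ denotes the set of nodes $e$ is incident upon. Each node $v$ has a capacity $c_v > 0$, and $\mu \geq 1$ is the multiplicity of an edge ($\mu$ and the $c_v$ are polynomially bounded in $n$). The fractional hypergraph $b$-matching problem is the linear program: maximize $\sum_{e \in E} x(e)$ subject to $\sum_{e \in \mathcal{E}_v} x(e) \leq c_v$ for every $v \in V$ and $0 \leq x(e) \leq \mu$ for every $e \in E$. Its dual is: minimize $\sum_{v \in V} c_v y(v) + \sum_{e \in E} \mu z(e)$ subject to $z(e) + \sum_{v \in \mathcal{V}_e} y(v) \geq 1$ for every $e \in E$, and $y(v), z(e) \geq 0$. For $\lambda \geq 1$, a feasible solution $\{x(e)\}$ of the primal LP is called $\lambda$-maximal iff for every edge $e \in E$ with $x(e) < \mu$ there is some node $v \in \mathcal{V}_e$ such that $\sum_{e' \in \mathcal{E}_v} x(e') \geq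 c_v/\lambda$. *)

theory Defs
  imports "HOL-Analysis.Analysis"
begin

text \<open>
  A hypergraph is given by its nodes \<open>V\<close>, its edges \<open>E\<close> and the map \<open>\<E>\<close> sending a node to the
  set of edges incident upon it.  Edges are abstract objects, so distinct edges may be incident
  upon the same set of nodes.
\<close>

definition hypergraph :: "'v set \<Rightarrow> 'e set \<Rightarrow> ('v \<Rightarrow> 'e set) \<Rightarrow> bool" where
  "hypergraph V E \<E> \<longleftrightarrow> finite V \<and> finite E \<and> (\<forall>v\<in>V. \<E> v \<subseteq> E)"

definition edge_nodes :: "'v set \<Rightarrow> ('v \<Rightarrow> 'e set) \<Rightarrow> 'e \<Rightarrow> 'v set" where
  "edge_nodes V \<E> e = {v \<in> V. e \<in> \<E> v}"

text \<open>Values of a solution \<open>x\<close> outside \<open>E\<close> are irrelevant in all definitions below.\<close>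

definition lp_feasible ::
  "'v set \<Rightarrow> 'e set \<Rightarrow> ('v \<Rightarrow> 'e set) \<Rightarrow> ('v \<Rightarrow> real) \<Rightarrow> real \<Rightarrow> ('e \<Rightarrow> real) \<Rightarrow> bool" where
  "lp_feasible V E \<E> c \<mu> x \<longleftrightarrow>
     (\<forall>v\<in>V. (\<Sum>e\<in>\<E> v. x e) \<le> c v) \<and> (\<forall>e\<in>E. 0 \<le> x e \<and> x e \<le> \<mu>)"

definition lp_objective :: "'e set \<Rightarrow> ('e \<Rightarrow> real) \<Rightarrow> real" where
  "lp_objective E x = (\<Sum>e\<in>E. x e)"

definition lp_opt ::
  "'v set \<Rightarrow> 'e set \<Rightarrow> ('v \<Rightarrow> 'e set) \<Rightarrow> ('v \<Rightarrow> real) \<Rightarrow> real \<Rightarrow> real" where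
  "lp_opt V E \<E> c \<mu> = (SUP x\<in>{x. lp_feasible V E \<E> c \<mu> x}. lp_objective E x)"

definition lambda_maximal ::
  "'v set \<Rightarrow> 'e set \<Rightarrow> ('v \<Rightarrow> 'e set) \<Rightarrow> ('v \<Rightarrow> real) \<Rightarrow> real \<Rightarrow> real \<Rightarrow> ('e \<Rightarrow> real) \<Rightarrow> bool" where
  "lambda_maximal V E \<E> c \<mu> l x \<longleftrightarrow>
     lp_feasible V E \<E> c \<mu> x \<and>
     (\<forall>e\<in>E. x e < \<mu> \<longrightarrow> (\<exists>v\<in>edge_nodes V \<E> e. (\<Sum>e'\<in>\<E> v. x e') \<ge> c v / l))"

text \<open>The supremum in \<^const>\<open>lp_opt\<close> is a maximum.\<close>

lemma lp_opt_attained: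
  fixes \<mu> :: real
  assumes H: "hypergraph V E \<E>" and c: "\<And>v. v \<in> V \<Longrightarrow> c v > 0" and mu: "\<mu> \<ge> 1"
  shows "\<exists>x. lp_feasible V E \<E> c \<mu> x \<and> lp_objective E x = lp_opt V E \<E> c \<mu> \<and>
             (\<forall>x'. lp_feasible V E \<E> c \<mu> x' \<longrightarrow> lp_objective E x' \<le> lp_objective E x)"
proof -
  define K where "K = {x. lp_feasible V E \<E> c \<mu> x \<and> (\<forall>e. e \<notin> E \<longrightarrow> x e = 0)}"
  define B where "B = (\<Pi>\<^sub>E e\<in>UNIV. if e \<in> E then {0..\<mu>} else {0::real})"
  have cB: "compact B"
    using compactin_PiE[of "\<lambda>_. euclidean" UNIV "\<lambda>e. if e \<in> E then {0..\<mu>} else {0::real}"]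
    by (simp add: B_def euclidean_product_topology)
  have K_eq: "K = B \<inter> (\<Inter>v\<in>V. {x. (\<Sum>e\<in>\<E> v. x e) \<le> c v})"
    unfolding K_def B_def lp_feasible_def by (auto simp: PiE_iff split: if_splits)
  have cl: "closed {x :: 'b \<Rightarrow> real. (\<Sum>e\<in>A. x e) \<le> d}" for A and d :: real
    by (intro closed_Collect_le continuous_intros continuous_on_product_coordinates)
  have cK: "compact K"
    unfolding K_eq using cl by (intro compact_Int_closed cB closed_INT) auto
  have "(\<lambda>_. 0) \<in> K"
    using c mu unfolding K_def lp_feasible_def by (auto intro: less_imp_le)
  then have ne: "K \<noteq> {}" by auto
  have "continuous_on K (lp_objective E)"
    unfolding lp_objective_def
    by (intro continuous_intros continuous_on_subset[OF continuous_on_product_coordinates]) auto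
  from continuous_attains_sup[OF cK ne this]
  obtain x where x: "x \<in> K" and mx: "\<And>y. y \<in> K \<Longrightarrow> lp_objective E y \<le> lp_objective E x"
    by auto
  have fx: "lp_feasible V E \<E> c \<mu> x" using x by (simp add: K_def)
  have mx': "lp_objective E y \<le> lp_objective E x" if y: "lp_feasible V E \<E> c \<mu> y" for y
  proof -
    let ?y = "\<lambda>e. if e \<in> E then y e else 0"
    have "(\<Sum>e\<in>\<E> v. ?y e) = (\<Sum>e\<in>\<E> v. y e)" if "v \<in> V" for v
      using H that unfolding hypergraph_def by (intro sum.cong) auto
    then have "?y \<in> K" using y unfolding K_def lp_feasible_def by simp
    from mx[OF this] show ?thesis by (simp add: lp_objective_def)
  qed
  have "lp_opt V E \<E> c \<mu> = lp_objective E x"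
    unfolding lp_opt_def using fx mx' by (intro cSup_eq_maximum) auto
  then show ?thesis using fx mx' by auto
qed

end

theory Submission
  imports Defs
begin

text \<open>
  Weak LP duality: let \<open>y\<close> be the indicator of the nodes whose load is at least \<open>c v / l\<close> and
  \<open>z\<close> the indicator of the edges with \<open>x e = \<mu>\<close>.  Maximality of \<open>x\<close> says precisely that \<open>(y, z)\<close>
  is dual feasible.  A chosen node costs at most \<open>l\<close> times its load, and each edge contributes to
  at most \<open>f\<close> loads, so the nodes cost at most \<open>l * f\<close> times the objective of \<open>x\<close>; the chosen
  edges cost at most the objective itself.
\<close>

text \<open>Double counting: both sides add up \<open>y v * x e\<close> over all incident pairs of a
  node and an edge.\<close>

lemma sum_weighted_loads:
  fixes x :: "'e \<Rightarrow> real" and y :: "'v \<Rightarrow> real"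
  assumes "hypergraph V E \<E>"
  shows "(\<Sum>v\<in>V. y v * (\<Sum>e\<in>\<E> v. x e)) = (\<Sum>e\<in>E. x e * (\<Sum>v\<in>edge_nodes V \<E> e. y v))"
proof -
  have fin: "finite V" "finite E" and sub: "\<And>v. v \<in> V \<Longrightarrow> \<E> v \<subseteq> E"
    using assms by (auto simp: hypergraph_def)
  have eq: "{e \<in> E. e \<in> \<E> v} = \<E> v" if "v \<in> V" for v
    using sub[OF that] by auto
  have "(\<Sum>v\<in>V. y v * (\<Sum>e\<in>\<E> v. x e)) = (\<Sum>v\<in>V. \<Sum>e | e \<in> E \<and> e \<in> \<E> v. y v * x e)"
    by (intro sum.cong) (simp_all add: eq sum_distrib_left)
  also have "\<dots> = (\<Sum>e\<in>E. \<Sum>v | v \<in> V \<and> e \<in> \<E> v. y v * x e)"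
    using fin by (rule sum.swap_restrict)
  finally show ?thesis
    by (simp add: edge_nodes_def sum_distrib_left mult.commute)
qed

text \<open>Scale each dual constraint by \<open>x e\<close> and regroup the node terms by nodes;
  the primal bounds on loads and on \<open>x e\<close> then apply, as \<open>y\<close> and
  \<open>z\<close> are nonnegative.\<close>

lemma lp_weak_duality:
  fixes x :: "'e \<Rightarrow> real" and y :: "'v \<Rightarrow> real" and z :: "'e \<Rightarrow> real"
  assumes H: "hypergraph V E \<E>"
    and x: "lp_feasible V E \<E> c \<mu> x"
    and y: "\<And>v. v \<in> V \<Longrightarrow> 0 \<le> y v" and z: "\<And>e. e \<in> E \<Longrightarrow> 0 \<le> z e"
    and dual: "\<And>e. e \<in> E \<Longrightarrow> 1 \<le> z e + (\<Sum>v\<in>edge_nodes V \<E> e. y v)"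
  shows "lp_objective E x \<le> (\<Sum>v\<in>V. c v * y v) + (\<Sum>e\<in>E. \<mu> * z e)"
proof -
  have "lp_objective E x \<le> (\<Sum>e\<in>E. x e * (z e + (\<Sum>v\<in>edge_nodes V \<E> e. y v)))"
    unfolding lp_objective_def
  proof (rule sum_mono)
    fix e assume e: "e \<in> E"
    then have "0 \<le> x e" using x by (simp add: lp_feasible_def)
    from mult_left_mono[OF dual[OF e] this]
    show "x e \<le> x e * (z e + (\<Sum>v\<in>edge_nodes V \<E> e. y v))" by simp
  qed
  also have "\<dots> = (\<Sum>v\<in>V. y v * (\<Sum>e\<in>\<E> v. x e)) + (\<Sum>e\<in>E. x e * z e)"
    by (simp add: sum_weighted_loads[OF H] distrib_left sum.distrib)
  also have "\<dots> \<le> (\<Sum>v\<in>V. y v * c v) + (\<Sum>e\<in>E. \<mu> * z e)"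
    using x y z unfolding lp_feasible_def
    by (intro add_mono sum_mono mult_left_mono mult_right_mono) auto
  finally show ?thesis by (simp add: mult.commute)
qed

text \<open>Comparing with an arbitrary feasible \<open>x'\<close>, in product form, keeps the
  supremum and the division out of the argument.\<close>

lemma lambda_maximal_approx:
  fixes \<mu> l f :: real
  assumes H: "hypergraph V E \<E>"
    and l: "l > 0"
    and f: "\<And>e. e \<in> E \<Longrightarrow> real (card (edge_nodes V \<E> e)) \<le> f"
    and max: "lambda_maximal V E \<E> c \<mu> l x"
    and x': "lp_feasible V E \<E> c \<mu> x'"
  shows "lp_objective E x' \<le> (l * f + 1) * lp_objective E x"
proof -
  have fin: "finite V" using H by (simp add: hypergraph_def)
  have x0: "0 \<le> x e" "x e \<le> \<mu>" if "e \<in> E" for e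
    using max that by (auto simp: lambda_maximal_def lp_feasible_def)
  define y :: "'a \<Rightarrow> real" where "y v = of_bool ((\<Sum>e\<in>\<E> v. x e) \<ge> c v / l)" for v
  define z :: "'b \<Rightarrow> real" where "z e = of_bool (x e = \<mu>)" for e
  have dual: "1 \<le> z e + (\<Sum>v\<in>edge_nodes V \<E> e. y v)" if e: "e \<in> E" for e
  proof (cases "x e = \<mu>")
    case True
    then show ?thesis by (simp add: z_def y_def sum_nonneg)
  next
    case False
    with x0[OF e] have "x e < \<mu>" by simp
    with max e obtain v where v: "v \<in> edge_nodes V \<E> e" "(\<Sum>e'\<in>\<E> v. x e') \<ge> c v / l"
      by (auto simp: lambda_maximal_def)
    have "finite (edge_nodes V \<E> e)" using fin by (simp add: edge_nodes_def)
    with v(1) have "y v \<le> (\<Sum>v\<in>edge_nodes V \<E> e. y v)"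
      by (intro member_le_sum) (simp_all add: y_def)
    moreover have "y v = 1" using v(2) by (simp add: y_def)
    ultimately show ?thesis by (simp add: z_def)
  qed
  have "lp_objective E x' \<le> (\<Sum>v\<in>V. c v * y v) + (\<Sum>e\<in>E. \<mu> * z e)"
    using lp_weak_duality[OF H x' _ _ dual] by (simp add: y_def z_def)
  \<comment> \<open>Termwise: if \<open>y v = 1\<close>, the threshold in \<open>y\<close> gives
    \<open>c v\<close> \<le> \<open>l\<close> times the load of \<open>v\<close>; otherwise both
    sides are 0.\<close>
  also have "(\<Sum>v\<in>V. c v * y v) \<le> (\<Sum>v\<in>V. l * (y v * (\<Sum>e\<in>\<E> v. x e)))"
    using l by (intro sum_mono) (simp add: y_def pos_divide_le_eq mult.commute)
  also have "\<dots> = l * (\<Sum>e\<in>E. x e * (\<Sum>v\<in>edge_nodes V \<E> e. y v))"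
    by (simp add: sum_weighted_loads[OF H] flip: sum_distrib_left)
  \<comment> \<open>After the exchange of sums, \<open>x e\<close> is charged once for each chosen
    node of \<open>e\<close>, so at most \<open>f\<close> times.\<close>
  also have "\<dots> \<le> l * (\<Sum>e\<in>E. x e * f)"
  proof (intro mult_left_mono sum_mono)
    fix e assume e: "e \<in> E"
    have "(\<Sum>v\<in>edge_nodes V \<E> e. y v) \<le> real (card (edge_nodes V \<E> e)) * 1"
      by (rule sum_bounded_above) (simp add: y_def)
    with f[OF e] show "(\<Sum>v\<in>edge_nodes V \<E> e. y v) \<le> f" by simp
  qed (use l x0 in auto)
  \<comment> \<open>An edge with \<open>z e = 1\<close> is saturated, so it pays its cost \<mu>
    exactly with \<open>x e\<close>.\<close>
  also have "(\<Sum>e\<in>E. \<mu> * z e) \<le> (\<Sum>e\<in>E. x e)"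
    using x0 by (intro sum_mono) (auto simp: z_def)
  finally show ?thesis
    by (simp add: lp_objective_def algebra_simps flip: sum_distrib_left)
qed

theorem theorem1:
  fixes V :: "'v set" and E :: "'e set" and \<E> :: "'v \<Rightarrow> 'e set"
    and c :: "'v \<Rightarrow> real" and \<mu> l f :: real and x :: "'e \<Rightarrow> real"
  assumes "hypergraph V E \<E>"
    and "\<And>v. v \<in> V \<Longrightarrow> c v > 0"
    and "\<mu> \<ge> 1"
    and "l \<ge> 1"
    and "\<And>e. e \<in> E \<Longrightarrow> real (card (edge_nodes V \<E> e)) \<le> f"
    and "lambda_maximal V E \<E> c \<mu> l x"
  shows "lp_objective E x \<ge> lp_opt V E \<E> c \<mu> / (l * f + 1)"
proof -
  obtain x' where x': "lp_feasible V E \<E> c \<mu> x'" "lp_objective E x' = lp_opt V E \<E> c \<mu>"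
    using lp_opt_attained[of V E \<E> c \<mu>] assms(1-3) by blast
  show ?thesis
  proof (cases "E = {}")
    case True
    \<comment> \<open>Only here can \<open>f\<close> be negative.\<close>
    then show ?thesis using x'(2) by (simp add: lp_objective_def)
  next
    case False
    then obtain e where "e \<in> E" by auto
    \<comment> \<open>\<open>f\<close> bounds a cardinality; this makes the denominator
      \<open>l * f + 1\<close> positive, so the division can be cleared.\<close>
    then have "0 \<le> f" using assms(5)[of e] by linarith
    then have "0 \<le> l * f" using assms(4) by simp
    moreover have "lp_opt V E \<E> c \<mu> \<le> (l * f + 1) * lp_objective E x"
      using lambda_maximal_approx[OF assms(1) _ assms(5,6) x'(1)] assms(4) x'(2) by simp
    ultimately show ?thesis by (simp add: pos_divide_le_eq mult.commute)
  qed
qed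

end
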